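(* Let $X$ be a real normed space with dual $X^*$, let $\Omega\subset X$, let $\bar x\in\Omega$, let $\varepsilon\ge 0$, and let $x^*\in X^*$. Then $x^*\in\widehat N_\varepsilon(\bar x;\Omega)$ if and only if $\bar x$ is a local stationary trap relative to $\Omega$ with the linear utility function $u_{x^*}(x)=\langle x^*,x\rangle$ and any weight factor $\xi>\varepsilon$.
   Context: The set of $\varepsilon$-normals to $\Omega$ at $\bar x\in\Omega$ is $$\widehat N_\varepsilon(\bar x;\Omega):=\Big\{x^*\in X^*\ \Big|\ \limsup_{x\overset{\Omega}{\to}\bar x}\frac{\langle x^*,x-\bar x\rangle}{\|x-\bar x\|}\le\varepsilon\Big\},$$ where $x\overset{\Omega}{\to}\bar x$ means $x\to\bar x$ with $x\in\Omega$ (and $x\ne\bar x$ in the quotient). For $\xi\ge 0$, the proximal payoff of the "to be increased" utility $u_{x^*}$ is $P_{\xi,x^*}(x/\bar x):=u_{x^*}(x)-\xi\|x-\bar x\|$. The point $\bar x$ is a local stationary trap relative to $\Omega$ with the utility function $u_{x^*}$ and the weight factor $\xi$ if there is a neighborhood $V(\bar x)$ of $\bar x$ such that $P_{\xi,x^*}(x/\bar x)\le P_{\xi,x^*}(\bar x/\bar x)$ for all $x\in V(\bar x)\cap\Omega$, i.e. $\langle x^*,x-\bar x\rangle-\xi\|x-\bar x\|\le 0$ for all such $x$. "Any weight factor $\xi>\varepsilon$" means that this holds for every $\xi>\varepsilon$, with the neighborhood allowed to depend on $\xi$. *)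

theory Defs
  imports "HOL-Analysis.Analysis"
begin

text \<open>
  The filter \<open>at xbar within \<Omega>\<close> excludes \<open>xbar\<close>, so the quotient is never evaluated there.
  The upper limit is an extended real: at an isolated point of \<open>\<Omega>\<close> the filter is trivial, the
  upper limit is \<open>- \<infinity>\<close>, and every functional is a normal.
\<close>

definition eps_normals ::
    "real \<Rightarrow> 'a::real_normed_vector \<Rightarrow> 'a set \<Rightarrow> ('a \<Rightarrow>\<^sub>L real) set" where
  "eps_normals \<epsilon> xbar \<Omega> =
     {xs. Limsup (at xbar within \<Omega>)
            (\<lambda>x. ereal (blinfun_apply xs (x - xbar) / norm (x - xbar))) \<le> ereal \<epsilon>}"

definition proximal_payoff ::
    "real \<Rightarrow> ('a::real_normed_vector \<Rightarrow> real) \<Rightarrow> 'a \<Rightarrow> 'a \<Rightarrow> real" where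
  "proximal_payoff \<xi> u x xbar = u x - \<xi> * norm (x - xbar)"

definition local_stationary_trap ::
    "'a::real_normed_vector set \<Rightarrow> ('a \<Rightarrow> real) \<Rightarrow> real \<Rightarrow> 'a \<Rightarrow> bool" where
  "local_stationary_trap \<Omega> u \<xi> xbar \<longleftrightarrow>
     (\<exists>V. open V \<and> xbar \<in> V \<and>
        (\<forall>x \<in> V \<inter> \<Omega>. proximal_payoff \<xi> u x xbar \<le> proximal_payoff \<xi> u xbar xbar))"

end

theory Submission
  imports Defs
begin

text \<open>By linearity the trap inequality at \<open>x\<close> reads
  \<open>xs (x - xbar) \<le> \<xi> * norm (x - xbar)\<close>; dividing by the norm when
  \<open>x \<noteq> xbar\<close>, it bounds the quotient in \<open>eps_normals\<close> by
  \<open>\<xi>\<close>. So a trap of weight \<open>\<xi>\<close> is an eventual bound on that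
  quotient. An upper limit is at most \<open>\<epsilon>\<close> exactly when every level above
  \<open>\<epsilon>\<close> is eventually a strict upper bound; since all levels above
  \<open>\<epsilon>\<close> are tested, strict and weak bounds, and real and extended real levels,
  amount to the same.\<close>

lemma local_stationary_trap_blinfun_iff:
  fixes xs :: "'a::real_normed_vector \<Rightarrow>\<^sub>L real"
  shows "local_stationary_trap \<Omega> (blinfun_apply xs) \<xi> xbar \<longleftrightarrow>
    (\<forall>\<^sub>F x in at xbar within \<Omega>. blinfun_apply xs (x - xbar) / norm (x - xbar) \<le> \<xi>)"
proof -
  \<comment> \<open>At \<open>x = xbar\<close> the payoffs coincide, so a condition on all of
    \<open>V \<inter> \<Omega>\<close> matches a filter that omits \<open>xbar\<close>.\<close>
  have payoff: "proximal_payoff \<xi> (blinfun_apply xs) x xbar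
      \<le> proximal_payoff \<xi> (blinfun_apply xs) xbar xbar \<longleftrightarrow>
      (x \<noteq> xbar \<longrightarrow> blinfun_apply xs (x - xbar) / norm (x - xbar) \<le> \<xi>)" for x
    by (cases "x = xbar")
       (auto simp: proximal_payoff_def blinfun.diff_right pos_divide_le_eq algebra_simps)
  show ?thesis
    unfolding local_stationary_trap_def payoff eventually_at_topological by blast
qed

theorem proposition6p1:
  fixes \<Omega> :: "'a::real_normed_vector set"
    and xbar :: 'a
    and \<epsilon> :: real
    and xs :: "'a \<Rightarrow>\<^sub>L real"
  assumes "xbar \<in> \<Omega>"
    and "\<epsilon> \<ge> 0"
  shows "xs \<in> eps_normals \<epsilon> xbar \<Omega> \<longleftrightarrow>
    (\<forall>\<xi>>\<epsilon>. local_stationary_trap \<Omega> (\<lambda>x. blinfun_apply xs x) \<xi> xbar)"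
proof -
  let ?q = "\<lambda>x. blinfun_apply xs (x - xbar) / norm (x - xbar)"
  let ?F = "at xbar within \<Omega>"
  \<comment> \<open>This characterization also holds for the trivial filter, so an isolated
    \<open>xbar\<close> needs no separate case.\<close>
  have "xs \<in> eps_normals \<epsilon> xbar \<Omega> \<longleftrightarrow> (\<forall>y>ereal \<epsilon>. \<forall>\<^sub>F x in ?F. ereal (?q x) < y)"
    by (simp add: eps_normals_def Limsup_le_iff)
  also have "\<dots> \<longleftrightarrow> (\<forall>\<xi>>\<epsilon>. \<forall>\<^sub>F x in ?F. ?q x \<le> \<xi>)"
  proof (intro iffI allI impI)
    fix \<xi> assume "\<forall>y>ereal \<epsilon>. \<forall>\<^sub>F x in ?F. ereal (?q x) < y" and "\<epsilon> < \<xi>"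
    then have "\<forall>\<^sub>F x in ?F. ereal (?q x) < ereal \<xi>"
      using less_ereal.simps(1) by blast
    then show "\<forall>\<^sub>F x in ?F. ?q x \<le> \<xi>"
      by (rule eventually_mono) simp
  next
    fix y assume traps: "\<forall>\<xi>>\<epsilon>. \<forall>\<^sub>F x in ?F. ?q x \<le> \<xi>" and "ereal \<epsilon> < y"
    \<comment> \<open>The level \<open>y\<close> may be \<infinity>, hence a real weight strictly
      below it; the gap turns the weak bound by \<open>\<xi>\<close> into a strict bound by
      \<open>y\<close>.\<close>
    then obtain \<xi> where "\<epsilon> < \<xi>" and "ereal \<xi> < y"
      using ereal_dense2 by fastforce
    with traps have "\<forall>\<^sub>F x in ?F. ?q x \<le> \<xi>"
      by simp
    then show "\<forall>\<^sub>F x in ?F. ereal (?q x) < y"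
      by (rule eventually_mono) (metis \<open>ereal \<xi> < y\<close> ereal_less_eq(3) le_less_trans)
  qed
  finally show ?thesis
    by (simp add: local_stationary_trap_blinfun_iff)
qed

end
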